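(* Let $S=K[x_1,\dots,x_n]$ be a standard graded polynomial ring over a field $K$ and let $I\subset S$ be a nonzero proper monomial ideal with linear powers such that $\mathrm{depth}\, S/I=0$. Then $$\mathrm{v}(I^k)=\alpha(I)k-1\quad\text{for all } k\ge1.$$
   Context: $S=\bigoplus_{d\ge0}S_d$ with $\deg x_i=1$. For a graded ideal $I\subset S$: $\mathrm{Ass}(I)$ is the set of associated primes of $S/I$, $\alpha(I)=\min\{d: I_d\neq 0\}$, and the v-number is $\mathrm{v}(I)=\min\{d: \exists f\in S_d\text{ with } (I:f)\in\mathrm{Ass}(I)\}$. A graded ideal $I$ has a $d$-linear resolution if it is generated in the single degree $d$ and its graded Betti numbers satisfy $\beta_{i,j}(I)=0$ for all $i\ge0$ and $j\ne i+d$. $I$ has linear powers if $I^k$ has a linear resolution for all $k\ge1$. *)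

theory Defs
  imports
    "HOL-Library.Poly_Mapping"
    "HOL-Library.Extended_Nat"
    "Jordan_Normal_Form.Matrix"
begin

text \<open>
  The polynomial ring over the field \<open>'a\<close> in finitely many variables indexed by the type \<open>'n\<close>:
  a polynomial maps exponent vectors to coefficients with finite support, and the product of
  \<open>HOL-Library.Poly_Mapping\<close> is the usual (convolution) product. The ring is the whole type.
\<close>

type_synonym ('n, 'a) poly_ring = "('n \<Rightarrow>\<^sub>0 nat) \<Rightarrow>\<^sub>0 'a"

subsection \<open>Ideals\<close>

abbreviation is_ideal :: "'r::comm_ring_1 set \<Rightarrow> bool" where
  "is_ideal \<equiv> module.subspace (*)"

abbreviation ideal_gen :: "'r::comm_ring_1 set \<Rightarrow> 'r set" where
  "ideal_gen \<equiv> module.span (*)"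

definition is_prime_ideal :: "'r::comm_ring_1 set \<Rightarrow> bool" where
  "is_prime_ideal P \<longleftrightarrow>
     is_ideal P \<and> P \<noteq> UNIV \<and> (\<forall>a b. a * b \<in> P \<longrightarrow> a \<in> P \<or> b \<in> P)"

definition ideal_mult :: "'r::comm_ring_1 set \<Rightarrow> 'r set \<Rightarrow> 'r set" where
  "ideal_mult I J = ideal_gen {a * b | a b. a \<in> I \<and> b \<in> J}"

primrec ideal_power :: "'r::comm_ring_1 set \<Rightarrow> nat \<Rightarrow> 'r set" where
  "ideal_power I 0 = UNIV"
| "ideal_power I (Suc k) = ideal_mult I (ideal_power I k)"

definition colon :: "'r::comm_ring_1 set \<Rightarrow> 'r \<Rightarrow> 'r set" where
  "colon I f = {g. g * f \<in> I}"

text \<open>The associated primes of \<open>S/I\<close>; the annihilator of the class of \<open>f\<close> is \<open>I : f\<close>.\<close>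

definition Ass :: "'r::comm_ring_1 set \<Rightarrow> 'r set set" where
  "Ass I = {P. is_prime_ideal P \<and> (\<exists>f. P = colon I f)}"

subsection \<open>Grading\<close>

definition total_degree :: "('n::finite \<Rightarrow>\<^sub>0 nat) \<Rightarrow> nat" where
  "total_degree m = (\<Sum>i\<in>UNIV. Poly_Mapping.lookup m i)"

text \<open>The graded component \<open>S\<^sub>d\<close>, which contains \<open>0\<close>.\<close>

definition homog :: "nat \<Rightarrow> ('n::finite, 'a::field) poly_ring set" where
  "homog d = {f. \<forall>m\<in>Poly_Mapping.keys f. total_degree m = d}"

definition max_ideal :: "('n::finite, 'a::field) poly_ring set" where
  "max_ideal = ideal_gen {Poly_Mapping.single (Poly_Mapping.single i 1) 1 | i. True}"

definition is_monomial_ideal :: "('n::finite, 'a::field) poly_ring set \<Rightarrow> bool" where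
  "is_monomial_ideal I \<longleftrightarrow> (\<exists>M. I = ideal_gen ((\<lambda>m. Poly_Mapping.single m 1) ` M))"

definition initial_degree :: "('n::finite, 'a::field) poly_ring set \<Rightarrow> nat" where
  "initial_degree I = (LEAST d. I \<inter> homog d \<noteq> {0})"

definition v_number :: "('n::finite, 'a::field) poly_ring set \<Rightarrow> nat" where
  "v_number I = (LEAST d. \<exists>f\<in>homog d. colon I f \<in> Ass I)"

subsection \<open>Depth\<close>

definition regular_sequence_mod :: "'r::comm_ring_1 set \<Rightarrow> 'r list \<Rightarrow> bool" where
  "regular_sequence_mod I fs \<longleftrightarrow>
     ideal_gen (I \<union> set fs) \<noteq> UNIV \<and>
     (\<forall>i<length fs. \<forall>g. g * fs ! i \<in> ideal_gen (I \<union> set (take i fs))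
        \<longrightarrow> g \<in> ideal_gen (I \<union> set (take i fs)))"

text \<open>\<open>depth S/I\<close>, with respect to the graded maximal ideal.\<close>

definition depth_mod :: "('n::finite, 'a::field) poly_ring set \<Rightarrow> enat" where
  "depth_mod I =
     Sup {enat (length fs) | fs. set fs \<subseteq> max_ideal \<and> regular_sequence_mod I fs}"

subsection \<open>Graded Betti numbers\<close>

text \<open>
  A list \<open>s\<close> of degrees stands for the graded free module with basis
  \<open>e\<^sub>0, e\<^sub>1, \<dots>\<close> where \<open>deg e\<^sub>k = s ! k\<close>, that is, for the direct sum of the \<open>S(- s ! k)\<close>.
  A matrix \<open>A\<close> acting on column vectors is a homomorphism of degree \<open>0\<close>
  from the module of \<open>s\<close> to that of \<open>t\<close>. Only resolutions of ideals are considered, so no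
  negative degrees occur.
\<close>

definition graded_hom ::
  "nat list \<Rightarrow> nat list \<Rightarrow> ('n::finite, 'a::field) poly_ring mat \<Rightarrow> bool" where
  "graded_hom s t A \<longleftrightarrow>
     A \<in> carrier_mat (length t) (length s) \<and>
     (\<forall>i<length t. \<forall>j<length s.
        A $$ (i, j) = 0 \<or> (\<exists>d. s ! j = t ! i + d \<and> A $$ (i, j) \<in> homog d))"

text \<open>
  A minimal graded free resolution
  \<open>\<dots> \<rightarrow> F\<^sub>2 \<rightarrow> F\<^sub>1 \<rightarrow> F\<^sub>0 \<rightarrow> I \<rightarrow> 0\<close> of the graded ideal \<open>I\<close>: the basis degrees of \<open>F\<^sub>i\<close> are \<open>F i\<close>,
  the map \<open>F\<^sub>i\<^sub>+\<^sub>1 \<rightarrow> F\<^sub>i\<close> is \<open>A (Suc i)\<close>, and \<open>A 0\<close> is the augmentation \<open>F\<^sub>0 \<rightarrow> I\<close>, regarded as a map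
  into the free module \<open>S\<close> of rank one. Minimality constrains the maps between the \<open>F\<^sub>i\<close>, but not the
  augmentation.
\<close>

definition minimal_graded_free_resolution ::
  "('n::finite, 'a::field) poly_ring set \<Rightarrow> (nat \<Rightarrow> nat list) \<Rightarrow>
     (nat \<Rightarrow> ('n, 'a) poly_ring mat) \<Rightarrow> bool" where
  "minimal_graded_free_resolution I F A \<longleftrightarrow>
     graded_hom (F 0) [0] (A 0) \<and>
     (\<forall>i. graded_hom (F (Suc i)) (F i) (A (Suc i))) \<and>
     I = {(A 0 *\<^sub>v v) $ 0 | v. v \<in> carrier_vec (length (F 0))} \<and>
     (\<forall>i. {v \<in> carrier_vec (length (F i)). A i *\<^sub>v v = 0\<^sub>v (dim_row (A i))} =
          {A (Suc i) *\<^sub>v w | w. w \<in> carrier_vec (length (F (Suc i)))}) \<and>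
     (\<forall>i. elements_mat (A (Suc i)) \<subseteq> max_ideal)"

text \<open>
  \<open>\<beta>\<close> is the family of graded Betti numbers \<open>\<beta>\<^sub>i\<^sub>,\<^sub>j(I)\<close>, i.e. the number of basis elements of degree \<open>j\<close>
  in step \<open>i\<close> of the minimal graded free resolution. The latter exists and is unique up to
  isomorphism, so every graded ideal has exactly one such \<open>\<beta>\<close>.
\<close>

definition has_graded_betti ::
  "('n::finite, 'a::field) poly_ring set \<Rightarrow> (nat \<Rightarrow> nat \<Rightarrow> nat) \<Rightarrow> bool" where
  "has_graded_betti I \<beta> \<longleftrightarrow>
     (\<exists>F A. minimal_graded_free_resolution I F A \<and> (\<forall>i j. \<beta> i j = count_list (F i) j))"

definition has_linear_resolution ::
  "nat \<Rightarrow> ('n::finite, 'a::field) poly_ring set \<Rightarrow> bool" where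
  "has_linear_resolution d I \<longleftrightarrow>
     (\<exists>G. G \<subseteq> homog d \<and> I = ideal_gen G) \<and>
     (\<exists>\<beta>. has_graded_betti I \<beta> \<and> (\<forall>i j. j \<noteq> i + d \<longrightarrow> \<beta> i j = 0))"

definition has_linear_powers :: "('n::finite, 'a::field) poly_ring set \<Rightarrow> bool" where
  "has_linear_powers I \<longleftrightarrow> (\<forall>k\<ge>1. \<exists>d. has_linear_resolution d (ideal_power I k))"

end

theory Submission
  imports Defs
begin

text \<open>
  Let \<open>d\<close> be the degree in which \<open>I\<close> is generated and \<open>\<mm>\<close> the ideal of all variables. The key
  point is that \<open>S/I\<close> has a socle monomial of degree \<open>d - 1\<close>: a monomial \<open>w \<notin> I\<close> with
  \<open>\<mm> w \<subseteq> I\<close> and \<open>deg w = d - 1\<close>. Given \<open>w\<close> and a monomial \<open>g \<in> I\<close> of degree \<open>d\<close>, the monomial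
  \<open>f = w g\<^sup>k\<^sup>-\<^sup>1\<close> has degree \<open>d k - 1\<close>, so it is not in \<open>I\<^sup>k\<close>, while \<open>\<mm> f \<subseteq> I\<^sup>k\<close>; hence
  \<open>(I\<^sup>k : f) = \<mm>\<close> and \<open>v(I\<^sup>k) \<le> d k - 1\<close> (\<open>colon_eq_max_ideal\<close>). Conversely, a prime
  \<open>(I\<^sup>k : f)\<close> contains the monomials of \<open>I\<^sup>k\<close>, hence a variable \<open>x\<close>, and \<open>0 \<noteq> x f \<in> I\<^sup>k\<close> forces
  \<open>deg f + 1 \<ge> d k\<close> (\<open>colon_associated_degree\<close>).

  Existence of a socle monomial (\<open>depth_zero_socle_monomial\<close>). Since the depth is zero, the sum of
  all variables is a zero divisor on \<open>S/I\<close>. If \<open>S/I\<close> had no socle monomial, every monomial outside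
  \<open>I\<close> would stay outside \<open>I\<close> under multiplication by all powers of some variable \<open>x\<^sub>i\<close>, and looking
  at the largest exponent of \<open>x\<^sub>i\<close> shows that then the sum of the variables is a nonzerodivisor.

  Its degree (\<open>linear_resolution_socle_degree\<close>). The linear resolution gives \<open>deg w < d\<close>, and
  \<open>deg w \<ge> d - 1\<close> because \<open>x w \<in> I\<close>. In the language of Koszul homology, \<open>w\<close> represents a class in
  \<open>Tor\<^sub>n(S/I, K)\<close> of degree \<open>deg w + n\<close>, and linearity puts this module in degree \<open>d + n - 1\<close>.
  Instead of Koszul complexes, the proof divides the resolution of \<open>S/I\<close> by one variable after the
  other. Dividing by \<open>r\<close> variables leaves a complex that is exact above homological degree \<open>r\<close>
  (\<open>exact_mod_var_ideal\<close>) and whose homology in degree \<open>r\<close> has a nonzero class killed by all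
  variables (\<open>socle_cycle_step\<close>). If \<open>deg w \<ge> d\<close>, this class has a representative with homogeneous
  entries of positive degree when \<open>r \<ge> 1\<close>; such entries vanish once all variables have been
  divided out, a contradiction.
\<close>

section \<open>Ideals in commutative rings\<close>

text \<open>
  The qualified name tells the locale from that of modules over ring records. It is not
  interpreted, as that would make its simplification rules for scalar multiplication, which rebracket
  products, rules for all commutative rings.
\<close>

lemma module_mult: "Modules.module ((*) :: 'r::comm_ring_1 \<Rightarrow> 'r \<Rightarrow> 'r)"
  by unfold_locales (simp_all add: algebra_simps)

lemmas ideal_span_add = Modules.module.span_add[OF module_mult]
  and ideal_span_mult = Modules.module.span_scale[OF module_mult]
  and ideal_span_zero = Modules.module.span_zero[OF module_mult]
  and ideal_span_diff = Modules.module.span_diff[OF module_mult]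
  and ideal_span_sum = Modules.module.span_sum[OF module_mult]
  and ideal_span_base = Modules.module.span_base[OF module_mult]
  and ideal_span_minimal = Modules.module.span_minimal[OF module_mult]
  and is_ideal_span = Modules.module.subspace_span[OF module_mult]

lemma ideal_gen_eq_self: "is_ideal I \<Longrightarrow> ideal_gen I = I"
  by (simp add: Modules.module.span_eq_iff[OF module_mult])

lemma is_ideal_iff:
  "is_ideal I \<longleftrightarrow> 0 \<in> I \<and> (\<forall>x\<in>I. \<forall>y\<in>I. x + y \<in> I) \<and> (\<forall>c. \<forall>x\<in>I. c * x \<in> I)"
  by (auto simp: Modules.module.subspace_def[OF module_mult])

lemma one_in_ideal: "is_ideal I \<Longrightarrow> 1 \<in> I \<Longrightarrow> I = UNIV"
  by (metis UNIV_eq_I is_ideal_iff mult.right_neutral)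

lemma is_ideal_colon: "is_ideal I \<Longrightarrow> is_ideal (colon I f)"
  by (auto simp: is_ideal_iff colon_def distrib_right mult.assoc)

lemma colon_eq_UNIV_iff: "is_ideal I \<Longrightarrow> colon I f = UNIV \<longleftrightarrow> f \<in> I"
proof
  assume "colon I f = UNIV"
  then have "1 \<in> colon I f" by simp
  then show "f \<in> I" by (simp add: colon_def)
qed (auto simp: colon_def is_ideal_iff)

section \<open>Monomials\<close>

text \<open>The monomial with exponent vector \<open>m\<close>, as a polynomial.\<close>

abbreviation mon :: "('n \<Rightarrow>\<^sub>0 nat) \<Rightarrow> ('n, 'a::field) poly_ring" where
  "mon m \<equiv> Poly_Mapping.single m 1"

text \<open>The exponent vector of the variable with index \<open>i\<close>.\<close>

abbreviation evar :: "'n \<Rightarrow> 'n \<Rightarrow>\<^sub>0 nat" where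
  "evar i \<equiv> Poly_Mapping.single i 1"

lemma lookup_single_mult:
  fixes p :: "'m::cancel_comm_monoid_add \<Rightarrow>\<^sub>0 'r::comm_ring_1"
  shows "Poly_Mapping.lookup (Poly_Mapping.single a c * p) (a + m) = c * Poly_Mapping.lookup p m"
  by (simp add: lookup_mult lookup_single when_mult mult_when)

lemma lookup_single_mult_0:
  fixes p :: "'m::cancel_comm_monoid_add \<Rightarrow>\<^sub>0 'r::comm_ring_1"
  assumes "\<nexists>t. m = a + t"
  shows "Poly_Mapping.lookup (Poly_Mapping.single a c * p) m = 0"
  using assms keys_mult[of "Poly_Mapping.single a c" p]
  by (auto simp: in_keys_iff split: if_splits)

lemma poly_eq_sum_single:
  "p = (\<Sum>m\<in>Poly_Mapping.keys p. Poly_Mapping.single m (Poly_Mapping.lookup p m))"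
  by (rule poly_mapping_eqI) (auto simp: lookup_sum lookup_single when_def in_keys_iff)

lemma in_ideal_gen_mon_iff:
  fixes p :: "('n, 'a::field) poly_ring"
  shows "p \<in> ideal_gen (mon ` M) \<longleftrightarrow> (\<forall>m\<in>Poly_Mapping.keys p. \<exists>a\<in>M. \<exists>t. m = a + t)"
    (is "_ \<longleftrightarrow> ?P p")
proof
  have "is_ideal {p :: ('n, 'a) poly_ring. ?P p}"
    unfolding is_ideal_iff
  proof (intro conjI ballI allI; clarsimp)
    fix x y :: "('n, 'a) poly_ring" and m
    assume "?P x" "?P y" "m \<in> Poly_Mapping.keys (x + y)"
    then show "\<exists>a\<in>M. \<exists>t. m = a + t" using keys_add[of x y] by blast
  next
    fix c x :: "('n, 'a) poly_ring" and m
    assume *: "?P x" "m \<in> Poly_Mapping.keys (c * x)"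
    then obtain s t where "m = s + t" "t \<in> Poly_Mapping.keys x"
      using keys_mult[of c x] by blast
    with *(1) show "\<exists>a\<in>M. \<exists>t. m = a + t" by (metis add.left_commute)
  qed
  moreover have "mon ` M \<subseteq> {p :: ('n, 'a) poly_ring. ?P p}"
    by (auto, metis add.right_neutral)
  ultimately have "ideal_gen (mon ` M) \<subseteq> {p. ?P p}" by (rule ideal_span_minimal[rotated])
  then show "p \<in> ideal_gen (mon ` M) \<Longrightarrow> ?P p" by blast
next
  assume P: "?P p"
  have "Poly_Mapping.single m (Poly_Mapping.lookup p m) \<in> ideal_gen (mon ` M)"
    if m: "m \<in> Poly_Mapping.keys p" for m
  proof -
    obtain a t where "a \<in> M" "m = a + t" using P m by blast
    then have "Poly_Mapping.single m (Poly_Mapping.lookup p m)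
        = Poly_Mapping.single t (Poly_Mapping.lookup p m) * mon a"
      by (simp add: mult_single add.commute)
    then show ?thesis using \<open>a \<in> M\<close> by (auto intro: ideal_span_mult ideal_span_base)
  qed
  then show "p \<in> ideal_gen (mon ` M)"
    by (subst poly_eq_sum_single) (rule ideal_span_sum)
qed

lemma monomial_ideal_is_ideal: "is_monomial_ideal I \<Longrightarrow> is_ideal I"
  unfolding is_monomial_ideal_def using is_ideal_span by blast

lemma monomial_ideal_iff:
  assumes "is_monomial_ideal (I :: ('n::finite, 'a::field) poly_ring set)"
  shows "p \<in> I \<longleftrightarrow> (\<forall>m\<in>Poly_Mapping.keys p. mon m \<in> I)"
proof -
  obtain M where I: "I = ideal_gen (mon ` M)" using assms by (auto simp: is_monomial_ideal_def)
  show ?thesis unfolding I in_ideal_gen_mon_iff by auto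
qed

lemma mon_add: "(mon (a + b) :: ('n, 'a::field) poly_ring) = mon a * mon b"
  by (simp add: mult_single)

lemma mon_power: "(mon a :: ('n, 'a::field) poly_ring) ^ k = mon (\<Sum>j<k. a)"
  by (induction k) (simp_all add: mult_single add.commute)

lemma in_ideal_mon_add: "is_ideal I \<Longrightarrow> mon a \<in> I \<Longrightarrow> mon (a + b) \<in> I"
  by (metis add.commute is_ideal_iff mon_add)

lemma add_evar_iff: "(\<exists>t. m = evar i + t) \<longleftrightarrow> Poly_Mapping.lookup m i \<noteq> 0"
proof
  assume m: "Poly_Mapping.lookup m i \<noteq> 0"
  have "m = evar i + (m - evar i)"
    by (rule poly_mapping_eqI) (use m in \<open>auto simp: lookup_add lookup_minus lookup_single when_def\<close>)
  then show "\<exists>t. m = evar i + t" by blast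
qed (auto simp: lookup_add)

lemma total_degree_add: "total_degree (a + b) = total_degree a + total_degree b"
  by (simp add: total_degree_def lookup_add sum.distrib)

lemma total_degree_zero_iff: "total_degree m = 0 \<longleftrightarrow> m = 0"
  by (auto simp: total_degree_def intro: poly_mapping_eqI)

lemma total_degree_zero [simp]: "total_degree 0 = 0"
  by (simp add: total_degree_zero_iff)

lemma total_degree_single [simp]: "total_degree (Poly_Mapping.single i c) = c"
  by (simp add: total_degree_def lookup_single when_def)

lemma total_degree_sum: "total_degree (\<Sum>j\<in>A. f j) = (\<Sum>j\<in>A. total_degree (f j))"
  by (induction A rule: infinite_finite_induct) (auto simp: total_degree_add)

section \<open>Ideals generated by variables\<close>

text \<open>The prime ideal generated by the variables with index in \<open>V\<close>.\<close>

definition var_ideal :: "'n set \<Rightarrow> ('n, 'a::field) poly_ring set" where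
  "var_ideal V = ideal_gen (mon ` evar ` V)"

lemma in_var_ideal_iff:
  "p \<in> var_ideal V \<longleftrightarrow> (\<forall>m\<in>Poly_Mapping.keys p. \<exists>i\<in>V. Poly_Mapping.lookup m i \<noteq> 0)"
  unfolding var_ideal_def in_ideal_gen_mon_iff by (simp add: add_evar_iff del: One_nat_def)

lemma is_ideal_var_ideal: "is_ideal (var_ideal V)"
  by (simp add: var_ideal_def is_ideal_span)

lemma var_ideal_empty: "var_ideal {} = {0}"
  by (auto simp: in_var_ideal_iff)

lemma var_ideal_0: "0 \<in> var_ideal V"
  and var_ideal_add: "p \<in> var_ideal V \<Longrightarrow> q \<in> var_ideal V \<Longrightarrow> p + q \<in> var_ideal V"
  and var_ideal_diff: "p \<in> var_ideal V \<Longrightarrow> q \<in> var_ideal V \<Longrightarrow> p - q \<in> var_ideal V"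
  and var_ideal_mult: "p \<in> var_ideal V \<Longrightarrow> c * p \<in> var_ideal V"
  and var_ideal_sum: "(\<And>k. k \<in> A \<Longrightarrow> f k \<in> var_ideal V) \<Longrightarrow> sum f A \<in> var_ideal V"
  unfolding var_ideal_def
  by (auto intro: ideal_span_zero ideal_span_add ideal_span_diff ideal_span_mult ideal_span_sum)

lemma var_ideal_insertD:
  assumes "p \<in> var_ideal (insert x V)"
  obtains q where "p - mon (evar x) * q \<in> var_ideal V"
  using assms by (auto simp: var_ideal_def Modules.module.span_insert[OF module_mult] mult.commute)

lemma var_ideal_insertI:
  assumes "p - mon (evar x) * q \<in> var_ideal V"
  shows "p \<in> var_ideal (insert x V)"
  using assms by (auto simp: var_ideal_def Modules.module.span_insert[OF module_mult] mult.commute)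

text \<open>A variable outside \<open>V\<close> is a nonzerodivisor modulo \<open>var_ideal V\<close>.\<close>

lemma var_mult_in_var_idealD:
  assumes "x \<notin> V" "mon (evar x) * p \<in> var_ideal V"
  shows "p \<in> var_ideal V"
  unfolding in_var_ideal_iff
proof
  fix m assume "m \<in> Poly_Mapping.keys p"
  then have "evar x + m \<in> Poly_Mapping.keys (mon (evar x) * p)"
    by (simp add: in_keys_iff lookup_single_mult del: One_nat_def)
  then obtain i where i: "i \<in> V" "Poly_Mapping.lookup (evar x + m) i \<noteq> 0"
    using assms(2) unfolding in_var_ideal_iff by blast
  with assms(1) have "i \<noteq> x" by blast
  with i show "\<exists>i\<in>V. Poly_Mapping.lookup m i \<noteq> 0"
    by (auto simp: lookup_add lookup_single when_def split: if_splits)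
qed

lemma max_ideal_eq: "max_ideal = var_ideal UNIV"
  unfolding max_ideal_def var_ideal_def by (rule arg_cong[where f = ideal_gen]) auto

lemma in_max_ideal_iff: "p \<in> max_ideal \<longleftrightarrow> Poly_Mapping.lookup p 0 = 0"
proof -
  have "(\<exists>i. Poly_Mapping.lookup m i \<noteq> 0) \<longleftrightarrow> m \<noteq> 0" for m :: "'a \<Rightarrow>\<^sub>0 nat"
    by (metis lookup_zero poly_mapping_eqI)
  then show ?thesis unfolding max_ideal_eq in_var_ideal_iff
    by (auto simp: in_keys_iff)
qed

lemma is_prime_max_ideal: "is_prime_ideal (max_ideal :: ('n::finite, 'a::field) poly_ring set)"
  unfolding is_prime_ideal_def
proof (intro conjI allI impI)
  show "is_ideal (max_ideal :: ('n, 'a) poly_ring set)"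
    by (simp add: max_ideal_eq is_ideal_var_ideal)
  have "1 \<notin> (max_ideal :: ('n, 'a) poly_ring set)" by (simp add: in_max_ideal_iff)
  then show "(max_ideal :: ('n, 'a) poly_ring set) \<noteq> UNIV" by blast
next
  fix p q :: "('n, 'a) poly_ring"
  \<comment> \<open>Splitting off the constant term of \<open>p\<close> shows that constant terms multiply.\<close>
  have "(p - Poly_Mapping.single 0 (Poly_Mapping.lookup p 0)) * q \<in> max_ideal"
    by (subst mult.commute, unfold max_ideal_eq, rule var_ideal_mult)
      (simp flip: max_ideal_eq add: in_max_ideal_iff lookup_minus)
  then have "Poly_Mapping.lookup (p * q) 0 = Poly_Mapping.lookup p 0 * Poly_Mapping.lookup q 0"
    using lookup_single_mult[of 0 "Poly_Mapping.lookup p 0" q 0]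
    by (simp add: in_max_ideal_iff algebra_simps lookup_minus)
  then show "p * q \<in> max_ideal \<Longrightarrow> p \<in> max_ideal \<or> q \<in> max_ideal"
    by (simp add: in_max_ideal_iff)
qed

lemma prime_ideal_contains_var:
  fixes P :: "('n::finite, 'a::field) poly_ring set"
  assumes "is_prime_ideal P" "mon m \<in> P"
  shows "\<exists>i. mon (evar i) \<in> P"
  using assms(2)
proof (induction "total_degree m" arbitrary: m)
  case 0
  then have "1 \<in> P" by (simp add: total_degree_zero_iff)
  then show ?case using assms(1) one_in_ideal[of P] by (auto simp: is_prime_ideal_def)
next
  case (Suc n)
  have "m \<noteq> 0" using Suc.hyps(2) by auto
  then obtain i where "Poly_Mapping.lookup m i \<noteq> 0" by (metis lookup_zero poly_mapping_eqI)
  then obtain t where t: "m = evar i + t" using add_evar_iff by metis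
  then have "mon (evar i) * mon t \<in> P" using Suc.prems by (simp add: mon_add del: One_nat_def)
  then have "mon (evar i) \<in> P \<or> mon t \<in> P" using assms(1) unfolding is_prime_ideal_def by blast
  moreover have "n = total_degree t" using Suc.hyps(2) t by (simp add: total_degree_add del: One_nat_def)
  ultimately show ?case using Suc.hyps(1) by blast
qed

section \<open>Homogeneous components\<close>

text \<open>The homogeneous component of degree \<open>t\<close> of a polynomial; it is \<open>0\<close> if no monomial has that degree.\<close>

definition hcomp :: "nat \<Rightarrow> ('n::finite, 'a::field) poly_ring \<Rightarrow> ('n, 'a) poly_ring" where
  "hcomp t p = (\<Sum>m | m \<in> Poly_Mapping.keys p \<and> total_degree m = t.
     Poly_Mapping.single m (Poly_Mapping.lookup p m))"

lemma lookup_hcomp: "Poly_Mapping.lookup (hcomp t p) m = (Poly_Mapping.lookup p m when total_degree m = t)"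
  by (auto simp: hcomp_def lookup_sum lookup_single when_def in_keys_iff sum.If_cases)

lemma hcomp_add: "hcomp t (p + q) = hcomp t p + hcomp t q"
  by (rule poly_mapping_eqI) (simp add: lookup_hcomp lookup_add when_add_distrib)

lemma hcomp_diff: "hcomp t (p - q) = hcomp t p - hcomp t q"
  by (rule poly_mapping_eqI) (simp add: lookup_hcomp lookup_minus when_diff_distrib)

lemma hcomp_zero: "hcomp t 0 = 0"
  by (simp add: hcomp_def)

lemma hcomp_sum: "hcomp t (\<Sum>i\<in>A. f i) = (\<Sum>i\<in>A. hcomp t (f i))"
  by (induction A rule: infinite_finite_induct) (simp_all add: hcomp_zero hcomp_add)

lemma hcomp_in_homog: "hcomp t p \<in> homog t"
  by (auto simp: homog_def in_keys_iff lookup_hcomp)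

lemma hcomp_homog: "p \<in> homog t \<Longrightarrow> hcomp t p = p"
  by (rule poly_mapping_eqI) (auto simp: lookup_hcomp homog_def when_def in_keys_iff)

lemma hcomp_eq_0: "(\<And>m. m \<in> Poly_Mapping.keys p \<Longrightarrow> total_degree m \<noteq> t) \<Longrightarrow> hcomp t p = 0"
  by (rule poly_mapping_eqI) (auto simp: lookup_hcomp when_def in_keys_iff)

lemma zero_in_homog: "0 \<in> homog t"
  by (simp add: homog_def)

lemma homog_mult: "p \<in> homog s \<Longrightarrow> q \<in> homog t \<Longrightarrow> p * q \<in> homog (s + t)"
  using keys_mult[of p q] by (fastforce simp: homog_def total_degree_add)

lemma hcomp_mult:
  assumes "a \<in> homog s"
  shows "hcomp (s + t) (a * y) = a * hcomp t y"
proof -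
  have "hcomp (s + t) (a * (y - hcomp t y)) = 0"
  proof (rule hcomp_eq_0)
    fix m assume "m \<in> Poly_Mapping.keys (a * (y - hcomp t y))"
    then obtain u v where "m = u + v" "u \<in> Poly_Mapping.keys a" "v \<in> Poly_Mapping.keys (y - hcomp t y)"
      using keys_mult[of a] by blast
    moreover from this have "total_degree v \<noteq> t"
      by (auto simp: in_keys_iff lookup_minus lookup_hcomp)
    ultimately show "total_degree m \<noteq> s + t" using assms by (auto simp: homog_def total_degree_add)
  qed
  moreover have "hcomp (s + t) (a * hcomp t y) = a * hcomp t y"
    by (intro hcomp_homog homog_mult assms hcomp_in_homog)
  ultimately show ?thesis by (simp add: right_diff_distrib hcomp_diff)
qed

lemma hcomp_var_ideal: "p \<in> var_ideal V \<Longrightarrow> hcomp t p \<in> var_ideal V"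
  by (auto simp: in_var_ideal_iff in_keys_iff lookup_hcomp)

lemma homog_pos_in_var_ideal_UNIV: "p \<in> homog t \<Longrightarrow> t > 0 \<Longrightarrow> p \<in> var_ideal UNIV"
  by (simp flip: max_ideal_eq add: in_max_ideal_iff homog_def)
    (metis in_keys_iff total_degree_zero less_irrefl)

section \<open>Exact complexes of free modules modulo variables\<close>

text \<open>
  A complex \<open>\<dots> \<rightarrow> S\<^bsup>L 2\<^esup> \<rightarrow> S\<^bsup>L 1\<^esup> \<rightarrow> S\<^bsup>L 0\<^esup>\<close> of free modules that is exact
  except at its last module. An element of the \<open>j\<close>-th module is a function on \<open>nat\<close> of which only
  the values below \<open>L j\<close> matter. The map from module \<open>j + 1\<close> to module \<open>j\<close> is \<open>diff j\<close>, with matrix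
  \<open>D j\<close>; \<open>diff\<close> is a parameter only in order to abbreviate the sum.
\<close>

locale exact_complex =
  fixes L :: "nat \<Rightarrow> nat" and D :: "nat \<Rightarrow> nat \<Rightarrow> nat \<Rightarrow> ('n::finite, 'a::field) poly_ring"
  fixes diff :: "nat \<Rightarrow> (nat \<Rightarrow> ('n, 'a) poly_ring) \<Rightarrow> nat \<Rightarrow> ('n, 'a) poly_ring"
  defines "diff \<equiv> \<lambda>j y i. \<Sum>k<L (Suc j). D j i k * y k"
  assumes diff_diff: "\<And>j y i. i < L j \<Longrightarrow> diff j (diff (Suc j) y) i = 0"
    and exact: "\<And>j y. (\<And>i. i < L j \<Longrightarrow> diff j y i = 0) \<Longrightarrow>
      \<exists>u. \<forall>i<L (Suc j). y i = diff (Suc j) u i"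
begin

lemma diff_minus: "diff j (\<lambda>k. y k - z k) i = diff j y i - diff j z i"
  by (simp add: diff_def right_diff_distrib sum_subtractf)

lemma diff_scale: "diff j (\<lambda>k. c * y k) i = c * diff j y i"
  by (simp add: diff_def sum_distrib_left mult_ac)

lemma diff_in_var_ideal:
  "(\<And>k. k < L (Suc j) \<Longrightarrow> y k \<in> var_ideal V) \<Longrightarrow> diff j y i \<in> var_ideal V"
  unfolding diff_def by (auto intro!: var_ideal_sum var_ideal_mult)

text \<open>
  Dividing by the variables in \<open>V\<close> preserves exactness at the modules with index \<open>j + 1 > card V\<close>.
  By induction on \<open>V\<close>: each variable is a nonzerodivisor modulo the ideal of the previous ones, so
  the long exact homology sequence shows that dividing by it raises by at most one the highest index
  at which there is homology.
\<close>

lemma exact_mod_var_ideal: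
  assumes "finite V" "card V \<le> j" "\<And>i. i < L j \<Longrightarrow> diff j y i \<in> var_ideal V"
  shows "\<exists>u. \<forall>i<L (Suc j). y i - diff (Suc j) u i \<in> var_ideal V"
  using assms
proof (induction V arbitrary: j y rule: finite_induct)
  case empty
  then obtain u where "\<forall>i<L (Suc j). y i = diff (Suc j) u i"
    using exact[of j y] by (auto simp: var_ideal_empty)
  then show ?case by (auto simp: var_ideal_empty)
next
  case (insert x V)
  then obtain j' where j: "j = Suc j'" "card V \<le> j'" by (cases j) auto
  \<comment> \<open>If \<open>y\<close> is a cycle modulo \<open>V\<close> and \<open>X\<close>, write its image as \<open>X q\<close> modulo \<open>V\<close>; then \<open>q\<close> is a cycle
    modulo \<open>V\<close> and hence a boundary, which corrects \<open>y\<close> to a cycle modulo \<open>V\<close>.\<close>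
  define X :: "('n, 'a) poly_ring" where "X = mon (evar x)"
  have "\<forall>i. \<exists>q. i < L j \<longrightarrow> diff j y i - X * q \<in> var_ideal V"
    using insert.prems(2) var_ideal_insertD unfolding X_def by metis
  then obtain q where q: "\<And>i. i < L j \<Longrightarrow> diff j y i - X * q i \<in> var_ideal V" by metis
  have "diff j' q i \<in> var_ideal V" if i: "i < L j'" for i
  proof -
    have "diff j' (\<lambda>k. diff j y k - X * q k) i \<in> var_ideal V"
      by (rule diff_in_var_ideal) (use q j in auto)
    from var_ideal_diff[OF var_ideal_0 this] have "X * diff j' q i \<in> var_ideal V"
      using diff_diff[OF i] by (simp add: diff_minus diff_scale j)
    then show ?thesis
      using var_mult_in_var_idealD[OF insert.hyps(2)] by (simp add: X_def)
  qed
  from insert.IH[OF j(2) this] obtain u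
    where u: "\<forall>i<L j. q i - diff j u i \<in> var_ideal V" unfolding j by blast
  have "diff j (\<lambda>k. y k - X * u k) i \<in> var_ideal V" if "i < L j" for i
  proof -
    have "(diff j y i - X * q i) + X * (q i - diff j u i) \<in> var_ideal V"
      using q u that by (intro var_ideal_add var_ideal_mult) auto
    then show ?thesis by (simp add: diff_minus diff_scale algebra_simps)
  qed
  moreover have "card V \<le> j" using j by simp
  ultimately obtain t where t: "\<forall>i<L (Suc j). (y i - X * u i) - diff (Suc j) t i \<in> var_ideal V"
    using insert.IH by blast
  then have "\<forall>i<L (Suc j). y i - diff (Suc j) t i \<in> var_ideal (insert x V)"
    by (auto intro!: var_ideal_insertI[of _ x "u _"] simp: X_def algebra_simps)
  then show ?case by blast
qed

text \<open>
  Over \<open>S\<close> modulo the variables in \<open>V\<close>, the class of \<open>z\<close> in the cokernel of the map into the \<open>r\<close>-th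
  module is nonzero and killed by every variable. That \<open>z\<close> be a cycle is never needed, and not
  required.
\<close>

definition socle_cycle :: "'n set \<Rightarrow> nat \<Rightarrow> (nat \<Rightarrow> ('n, 'a) poly_ring) \<Rightarrow> bool" where
  "socle_cycle V r z \<longleftrightarrow>
     (\<forall>x. \<exists>u. \<forall>i<L r. mon (evar x) * z i - diff r u i \<in> var_ideal V) \<and>
     (\<nexists>u. \<forall>i<L r. z i - diff r u i \<in> var_ideal V)"

text \<open>
  The connecting homomorphism for division by a further variable \<open>x\<close>: as \<open>x z\<close> is the image of some
  \<open>y\<close> modulo \<open>V\<close>, this \<open>y\<close> is a cycle modulo \<open>V\<close> and \<open>x\<close>, and it inherits from \<open>z\<close> both properties of
  a socle cycle. It can be chosen homogeneous, in the degree \<open>t\<close> forced by \<open>deg (x z) = s + t\<close>.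
\<close>

lemma socle_cycle_step:
  assumes V: "finite V" "x \<notin> V" "card V = r"
    and z: "socle_cycle V r z" "\<And>i. i < L r \<Longrightarrow> z i \<in> homog c"
    and D: "\<And>i k. i < L r \<Longrightarrow> k < L (Suc r) \<Longrightarrow> D r i k \<in> homog s"
    and ct: "c + 1 = s + t"
  shows "\<exists>y. socle_cycle (insert x V) (Suc r) y \<and> (\<forall>i<L (Suc r). y i \<in> homog t)"
proof -
  define X :: "('n, 'a) poly_ring" where "X = mon (evar x)"
  obtain u where u: "\<forall>i<L r. X * z i - diff r u i \<in> var_ideal V"
    using z(1) unfolding socle_cycle_def X_def by blast
  define y where "y = (\<lambda>k. hcomp t (u k))"
  have Xhom: "X \<in> homog 1" by (simp add: X_def homog_def del: One_nat_def)
  have y: "X * z i - diff r y i \<in> var_ideal V" if i: "i < L r" for i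
  proof -
    have "hcomp (s + t) (X * z i) = X * z i"
      using homog_mult[OF Xhom z(2)[OF i]] ct by (simp add: hcomp_homog)
    moreover have "hcomp (s + t) (diff r u i) = diff r y i"
      unfolding diff_def y_def hcomp_sum by (intro sum.cong hcomp_mult D i) auto
    ultimately show ?thesis using hcomp_var_ideal[of "X * z i - diff r u i" V "s + t"] u i
      by (simp add: hcomp_diff)
  qed
  \<comment> \<open>If \<open>X z\<close> and \<open>X' z\<close> are the images of \<open>y\<close> and \<open>u'\<close>, then \<open>X' y - X u'\<close> is a cycle modulo \<open>V\<close> at
    an index where the complex is still exact, so \<open>X' y\<close> is a boundary modulo \<open>V\<close> and \<open>X\<close>.\<close>
  have "\<exists>w. \<forall>i<L (Suc r). mon (evar x') * y i - diff (Suc r) w i \<in> var_ideal (insert x V)" for x'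
  proof -
    define X' :: "('n, 'a) poly_ring" where "X' = mon (evar x')"
    obtain u' where u': "\<forall>i<L r. X' * z i - diff r u' i \<in> var_ideal V"
      using z(1) unfolding socle_cycle_def X'_def by blast
    have "diff r (\<lambda>k. X' * y k - X * u' k) i \<in> var_ideal V" if "i < L r" for i
    proof -
      have "X * (X' * z i - diff r u' i) - X' * (X * z i - diff r y i) \<in> var_ideal V"
        using u' y that by (intro var_ideal_diff[OF var_ideal_mult var_ideal_mult]) auto
      then show ?thesis by (simp add: diff_minus diff_scale algebra_simps)
    qed
    from exact_mod_var_ideal[OF V(1) eq_refl[OF V(3)] this]
    obtain w where "\<forall>i<L (Suc r). X' * y i - X * u' i - diff (Suc r) w i \<in> var_ideal V" by blast
    then have "\<forall>i<L (Suc r). X' * y i - diff (Suc r) w i \<in> var_ideal (insert x V)"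
      by (auto intro!: var_ideal_insertI[of _ x "u' _"] simp: X_def algebra_simps)
    then show ?thesis unfolding X'_def by blast
  qed
  \<comment> \<open>If \<open>y\<close> is a boundary plus \<open>X q\<close> modulo \<open>V\<close>, then \<open>X z\<close> is \<open>X\<close> times the image of \<open>q\<close>, and \<open>X\<close>
    cancels.\<close>
  moreover have False if b: "\<forall>i<L (Suc r). y i - diff (Suc r) b i \<in> var_ideal (insert x V)" for b
  proof -
    have "\<forall>i. \<exists>q. i < L (Suc r) \<longrightarrow> (y i - diff (Suc r) b i) - X * q \<in> var_ideal V"
      using b var_ideal_insertD unfolding X_def by metis
    then obtain q where q: "\<And>i. i < L (Suc r) \<Longrightarrow> (y i - diff (Suc r) b i) - X * q i \<in> var_ideal V"
      by metis
    have "z i - diff r q i \<in> var_ideal V" if i: "i < L r" for i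
    proof -
      have "diff r (\<lambda>k. (y k - diff (Suc r) b k) - X * q k) i \<in> var_ideal V"
        by (rule diff_in_var_ideal) (use q in auto)
      then have "diff r y i - X * diff r q i \<in> var_ideal V"
        using diff_diff[OF i] by (simp add: diff_minus diff_scale)
      from var_ideal_add[OF y[OF i] this] have "X * (z i - diff r q i) \<in> var_ideal V"
        by (simp add: algebra_simps)
      then show ?thesis using var_mult_in_var_idealD[OF V(2)] by (simp add: X_def)
    qed
    then show False using z(1) unfolding socle_cycle_def by blast
  qed
  ultimately have "socle_cycle (insert x V) (Suc r) y" unfolding socle_cycle_def by blast
  then show ?thesis by (auto simp: y_def hcomp_in_homog)
qed

text \<open>
  The matrix entries are of degree \<open>d\<close> in the last map and linear in all others, as in the linear
  resolution of an ideal generated in degree \<open>d\<close>. If \<open>z\<close> had degree \<open>e \<ge> d\<close>, dividing by all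
  variables would end with a socle cycle of positive degree \<open>e + 1 - d\<close>, which is zero modulo the
  variables.
\<close>

lemma socle_element_degree:
  assumes D0: "\<And>i k. i < L 0 \<Longrightarrow> k < L 1 \<Longrightarrow> D 0 i k \<in> homog d"
    and D1: "\<And>j i k. i < L (Suc j) \<Longrightarrow> k < L (Suc (Suc j)) \<Longrightarrow> D (Suc j) i k \<in> homog 1"
    and z: "socle_cycle {} 0 z" "\<And>i. i < L 0 \<Longrightarrow> z i \<in> homog e"
  shows "e < d"
proof (rule ccontr)
  assume "\<not> e < d"
  define c where "c r = (if r = 0 then e else e + 1 - d)" for r :: nat
  have D: "D r i k \<in> homog (if r = 0 then d else 1)" if "i < L r" "k < L (Suc r)" for r i k
    using D0 D1 that by (cases r) auto
  have "\<exists>z. socle_cycle V (card V) z \<and> (\<forall>i<L (card V). z i \<in> homog (c (card V)))" for V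
  proof (induction V rule: finite_induct[OF finite])
    case 1
    then show ?case using z by (auto simp: c_def)
  next
    case (2 x V)
    then obtain y where y: "socle_cycle V (card V) y" "\<forall>i<L (card V). y i \<in> homog (c (card V))"
      by blast
    have "c (card V) + 1 = (if card V = 0 then d else 1) + c (Suc (card V))"
      using \<open>\<not> e < d\<close> by (auto simp: c_def)
    from socle_cycle_step[OF 2(1) 2(2) refl y(1) y(2)[rule_format] D this]
    show ?case using 2(1,2) by simp
  qed
  from this[of UNIV] obtain y
    where y: "socle_cycle UNIV (card (UNIV :: 'n set)) y"
      "\<forall>i<L (card (UNIV :: 'n set)). y i \<in> homog (e + 1 - d)"
    by (auto simp: c_def split: if_splits)
  then have "\<forall>i<L (card (UNIV :: 'n set)). y i - diff (card (UNIV :: 'n set)) (\<lambda>_. 0) i \<in> var_ideal UNIV"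
    using \<open>\<not> e < d\<close> by (auto simp: diff_def intro!: homog_pos_in_var_ideal_UNIV)
  with y(1) show False unfolding socle_cycle_def by blast
qed

end

section \<open>Socle degrees and linear resolutions\<close>

text \<open>
  The resolution \<open>F\<close> of \<open>I\<close> is shifted by one and extended by \<open>S\<close>, so that it becomes a resolution of
  \<open>S/I\<close>: module \<open>0\<close> is \<open>S\<close> and module \<open>i + 1\<close> is \<open>F\<^sub>i\<close>. A socle element of \<open>S/I\<close> is then a socle
  cycle at index \<open>0\<close>.
\<close>

lemma linear_resolution_socle_degree:
  fixes I :: "('n::finite, 'a::field) poly_ring set"
  assumes res: "has_linear_resolution d I"
    and w: "w \<in> homog e" "w \<notin> I" "\<And>i. mon (evar i) * w \<in> I"
  shows "e < d"
proof -
  obtain F A \<beta> where FA: "minimal_graded_free_resolution I F A"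
    "\<forall>i j. \<beta> i j = count_list (F i) j" "\<forall>i j. j \<noteq> i + d \<longrightarrow> \<beta> i j = 0"
    using res unfolding has_linear_resolution_def has_graded_betti_def by blast
  have F: "F i ! k = i + d" if "k < length (F i)" for i k
    using FA(2,3) that by (metis count_list_0_iff nth_mem)
  define L where "L j = (case j of 0 \<Rightarrow> 1 | Suc i \<Rightarrow> length (F i))" for j
  define D where "D j i k = A j $$ (i, k)" for j i k
  define diff where "diff \<equiv> \<lambda>j y i. \<Sum>k<L (Suc j). D j i k * y k"
  have L: "L 0 = 1" "\<And>j. L (Suc j) = length (F j)" by (simp_all add: L_def)
  have A: "A j \<in> carrier_mat (L j) (L (Suc j))" for j
    using FA(1) by (cases j) (auto simp: minimal_graded_free_resolution_def graded_hom_def L)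
  have D0: "D 0 i k \<in> homog d" if "i < L 0" "k < L 1" for i k
    using FA(1) that F[of k 0]
    by (auto simp: minimal_graded_free_resolution_def graded_hom_def L D_def zero_in_homog)
  have D1: "D (Suc j) i k \<in> homog 1" if "i < L (Suc j)" "k < L (Suc (Suc j))" for i j k
  proof -
    have "graded_hom (F (Suc j)) (F j) (A (Suc j))"
      using FA(1) by (auto simp: minimal_graded_free_resolution_def)
    then have "D (Suc j) i k = 0 \<or> (\<exists>e. Suc j + d = j + d + e \<and> D (Suc j) i k \<in> homog e)"
      using that F by (fastforce simp: graded_hom_def L D_def)
    then show ?thesis by (auto simp: zero_in_homog)
  qed
  have mult: "(A j *\<^sub>v v) $ i = diff j (($) v) i" if "v \<in> carrier_vec (L (Suc j))" "i < L j" for v i j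
    using that A[of j] by (auto simp: diff_def D_def scalar_prod_def atLeast0LessThan)
  have diff_cong: "diff j y i = diff j y' i" if "\<And>k. k < L (Suc j) \<Longrightarrow> y k = y' k" for j y y' i
    using that by (auto simp: diff_def)
  have im: "{v \<in> carrier_vec (L (Suc j)). A j *\<^sub>v v = 0\<^sub>v (L j)} =
      {A (Suc j) *\<^sub>v v | v. v \<in> carrier_vec (L (Suc (Suc j)))}" for j
  proof -
    have "dim_row (A j) = L j" using A[of j] by simp
    moreover have "{v \<in> carrier_vec (length (F j)). A j *\<^sub>v v = 0\<^sub>v (dim_row (A j))} =
        {A (Suc j) *\<^sub>v v | v. v \<in> carrier_vec (length (F (Suc j)))}"
      using FA(1) unfolding minimal_graded_free_resolution_def by blast
    ultimately show ?thesis by (simp add: L)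
  qed
  have diff_diff: "diff j (diff (Suc j) y) i = 0" if i: "i < L j"
    for j i and y :: "nat \<Rightarrow> ('n, 'a) poly_ring"
  proof -
    define v where "v = A (Suc j) *\<^sub>v vec (L (Suc (Suc j))) y"
    have "v \<in> carrier_vec (L (Suc j))" "A j *\<^sub>v v = 0\<^sub>v (L j)"
      using im[of j] unfolding v_def by (blast intro: vec_carrier)+
    then have "diff j (($) v) i = 0" using mult[of v j i] i by simp
    moreover have "v $ k = diff (Suc j) y k" if "k < L (Suc j)" for k
      unfolding v_def using that by (subst mult) (auto intro: diff_cong)
    ultimately show ?thesis using diff_cong by metis
  qed
  have exact: "\<exists>u. \<forall>i<L (Suc j). y i = diff (Suc j) u i"
    if *: "\<And>i. i < L j \<Longrightarrow> diff j y i = 0"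
    for j and y :: "nat \<Rightarrow> ('n, 'a) poly_ring"
  proof -
    have "A j *\<^sub>v vec (L (Suc j)) y = 0\<^sub>v (L j)"
    proof (rule eq_vecI)
      fix i assume "i < dim_vec (0\<^sub>v (L j) :: ('n, 'a) poly_ring vec)"
      then have i: "i < L j" by simp
      have "(A j *\<^sub>v vec (L (Suc j)) y) $ i = diff j y i"
        using i by (subst mult) (auto intro: diff_cong)
      then show "(A j *\<^sub>v vec (L (Suc j)) y) $ i = 0\<^sub>v (L j) $ i" using * i by simp
    qed (use A[of j] in auto)
    then have "vec (L (Suc j)) y \<in> {A (Suc j) *\<^sub>v v | v. v \<in> carrier_vec (L (Suc (Suc j)))}"
      unfolding im[symmetric] by simp
    then obtain u where u: "vec (L (Suc j)) y = A (Suc j) *\<^sub>v u" "u \<in> carrier_vec (L (Suc (Suc j)))"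
      by blast
    then have "y i = diff (Suc j) (($) u) i" if "i < L (Suc j)" for i
      using mult[OF u(2) that] that by (metis index_vec)
    then show ?thesis by blast
  qed
  interpret exact_complex L D diff
    using diff_diff exact by unfold_locales (simp_all only: diff_def)
  have I: "p \<in> I \<longleftrightarrow> (\<exists>u. p = diff 0 u 0)" for p
  proof -
    have "I = {(A 0 *\<^sub>v v) $ 0 | v. v \<in> carrier_vec (L 1)}"
      using FA(1) by (simp add: minimal_graded_free_resolution_def L)
    then have "p \<in> I \<longleftrightarrow> (\<exists>v\<in>carrier_vec (L 1). p = (A 0 *\<^sub>v v) $ 0)" by blast
    also have "\<dots> \<longleftrightarrow> (\<exists>v\<in>carrier_vec (L 1). p = diff 0 (($) v) 0)"
      by (rule bex_cong[OF refl]) (simp add: mult L)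
    also have "\<dots> \<longleftrightarrow> (\<exists>u. p = diff 0 u 0)"
    proof
      assume "\<exists>u. p = diff 0 u 0"
      then obtain u where "p = diff 0 u 0" ..
      also have "\<dots> = diff 0 (($) (vec (L 1) u)) 0" by (rule diff_cong) simp
      finally show "\<exists>v\<in>carrier_vec (L 1). p = diff 0 (($) v) 0" by (metis vec_carrier)
    qed blast
    finally show ?thesis .
  qed
  have "socle_cycle {} 0 (\<lambda>_. w)"
    using w(2,3) I by (simp add: socle_cycle_def L var_ideal_empty)
  then show ?thesis using socle_element_degree D0 D1 w(1) by blast
qed

section \<open>Depth zero\<close>

text \<open>
  If every variable has a power that multiplies the monomial \<open>u \<notin> I\<close> into \<open>I\<close>, then only finitely many
  multiples of \<open>u\<close> are outside \<open>I\<close>, and one of largest degree is in the socle of \<open>S/I\<close>.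
\<close>

lemma socle_monomial_above:
  fixes I :: "('n::finite, 'a::field) poly_ring set"
  assumes I: "is_ideal I" and u: "mon u \<notin> I"
    and tors: "\<And>i. \<exists>N. mon (u + Poly_Mapping.single i N) \<in> I"
  shows "\<exists>w. mon w \<notin> I \<and> (\<forall>i. mon (evar i + w) \<in> I)"
proof -
  obtain N where N: "\<And>i. mon (u + Poly_Mapping.single i (N i)) \<in> I" using tors by metis
  define B where "B = (\<Sum>i\<in>UNIV. N i)"
  have bound: "Poly_Mapping.lookup t i < N i" if "mon (u + t) \<notin> I" for t i
  proof (rule ccontr)
    assume *: "\<not> Poly_Mapping.lookup t i < N i"
    have "u + t = (u + Poly_Mapping.single i (N i)) + (t - Poly_Mapping.single i (N i))"
      by (rule poly_mapping_eqI)
        (use * in \<open>auto simp: lookup_add lookup_minus lookup_single when_def\<close>)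
    then show False using that in_ideal_mon_add[OF I N[of i]] by metis
  qed
  have "total_degree t \<le> B" if "mon (u + t) \<notin> I" for t
    unfolding total_degree_def B_def using bound[OF that] by (intro sum_mono less_imp_le)
  moreover have "mon (u + 0) \<notin> I" using u by simp
  ultimately obtain t where t: "mon (u + t) \<notin> I"
    and max: "\<And>t'. mon (u + t') \<notin> I \<Longrightarrow> total_degree t' \<le> total_degree t"
    using ex_has_greatest_nat[of "\<lambda>t. mon (u + t) \<notin> I" 0 total_degree "Suc B"]
    by (metis le_imp_less_Suc)
  have "mon (evar i + (u + t)) \<in> I" for i
  proof (rule ccontr)
    assume "mon (evar i + (u + t)) \<notin> I"
    then have "mon (u + (evar i + t)) \<notin> I" by (simp add: add.left_commute)
    from max[OF this] show False by (simp add: total_degree_add)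
  qed
  with t show ?thesis by blast
qed

text \<open>
  If \<open>x\<^sub>i v\<close> does not occur in the product of \<open>g\<close> with the sum of the variables although \<open>v\<close> occurs in
  \<open>g\<close>, then the term is cancelled by another monomial of \<open>g\<close>.
\<close>

lemma lookup_mult_sum_vars:
  fixes g :: "('n::finite, 'a::field) poly_ring"
  assumes "Poly_Mapping.lookup (g * (\<Sum>j\<in>UNIV. mon (evar j))) (evar i + v) = 0"
    and "Poly_Mapping.lookup g v \<noteq> 0"
  shows "\<exists>j v'. j \<noteq> i \<and> evar i + v = evar j + v' \<and> Poly_Mapping.lookup g v' \<noteq> 0"
proof (rule ccontr)
  assume no: "\<not> ?thesis"
  have *: "Poly_Mapping.lookup (mon (evar j) * g) (evar i + v) =
      (if j = i then Poly_Mapping.lookup g v else 0)" for j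
  proof (cases "j = i \<or> (\<nexists>v'. evar i + v = evar j + v')")
    case True
    then show ?thesis
      using lookup_single_mult[of "evar i" 1 g v] lookup_single_mult_0[of "evar i + v" "evar j" 1 g]
      by (auto simp del: One_nat_def)
  next
    case False
    then obtain v' where "evar i + v = evar j + v'" by blast
    with no False show ?thesis
      by (metis lookup_single_mult mult_1)
  qed
  have "Poly_Mapping.lookup (g * (\<Sum>j\<in>UNIV. mon (evar j))) (evar i + v)
      = (\<Sum>j\<in>UNIV. Poly_Mapping.lookup (mon (evar j) * g) (evar i + v))"
    by (simp add: sum_distrib_left lookup_sum mult.commute del: One_nat_def)
  also have "\<dots> = Poly_Mapping.lookup g v"
    unfolding * by simp
  finally show False using assms by simp
qed

lemma depth_zero_socle_monomial:
  fixes I :: "('n::finite, 'a::field) poly_ring set"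
  assumes mI: "is_monomial_ideal I" and proper: "I \<noteq> UNIV" and depth: "depth_mod I = 0"
  shows "\<exists>w. mon w \<notin> I \<and> (\<forall>i. mon (evar i + w) \<in> I)"
proof -
  note I = monomial_ideal_is_ideal[OF mI]
  \<comment> \<open>The sum of the variables lies in no prime ideal generated by variables other than \<open>max_ideal\<close>,
    so over any field it detects whether the depth is zero.\<close>
  define h :: "('n, 'a) poly_ring" where "h = (\<Sum>j\<in>UNIV. mon (evar j))"
  have mon_max: "mon (evar j) \<in> (max_ideal :: ('n, 'a) poly_ring set)" for j :: 'n
    unfolding max_ideal_def by (rule ideal_span_base) blast
  then have h: "h \<in> max_ideal" unfolding h_def max_ideal_eq by (intro var_ideal_sum) auto
  have max_ideal: "is_ideal (max_ideal :: ('n, 'a) poly_ring set)"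
    by (simp add: max_ideal_eq is_ideal_var_ideal)
  have "I \<subseteq> max_ideal"
  proof
    fix p assume p: "p \<in> I"
    have "Poly_Mapping.lookup p 0 = 0"
    proof (rule ccontr)
      assume "Poly_Mapping.lookup p 0 \<noteq> 0"
      then have "mon 0 \<in> I" using p mI monomial_ideal_iff by (metis in_keys_iff)
      then show False using one_in_ideal[OF I] proper by simp
    qed
    then show "p \<in> max_ideal" by (simp add: in_max_ideal_iff)
  qed
  then have "ideal_gen (I \<union> {h}) \<subseteq> max_ideal" using h max_ideal
    by (intro ideal_span_minimal) auto
  moreover have "1 \<notin> (max_ideal :: ('n, 'a) poly_ring set)" by (simp add: in_max_ideal_iff)
  ultimately have "ideal_gen (I \<union> {h}) \<noteq> UNIV" by blast
  moreover have "\<not> regular_sequence_mod I [h]"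
  proof
    assume "regular_sequence_mod I [h]"
    then have "enat 1 \<le> depth_mod I"
      unfolding depth_mod_def using h by (intro Sup_upper) (auto intro!: exI[of _ "[h]"])
    then show False using depth by (simp add: zero_enat_def)
  qed
  ultimately obtain g where g: "g * h \<in> I" "g \<notin> I"
    by (auto simp: regular_sequence_mod_def ideal_gen_eq_self[OF I])
  then obtain u where u: "Poly_Mapping.lookup g u \<noteq> 0" "mon u \<notin> I"
    using monomial_ideal_iff[OF mI, of g] by (auto simp: in_keys_iff)
  have "\<exists>N. mon (u + Poly_Mapping.single i N) \<in> I" for i
  proof (rule ccontr)
    assume contra: "\<not> ?thesis"
    \<comment> \<open>Among the monomials of \<open>g\<close> that all powers of \<open>x\<^sub>i\<close> leave outside \<open>I\<close>, take one with the largest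
      exponent of \<open>x\<^sub>i\<close>. A monomial cancelling \<open>x\<^sub>i v\<close> has a larger exponent and is of the same kind.\<close>
    define T where "T = {v \<in> Poly_Mapping.keys g. \<forall>N. mon (v + Poly_Mapping.single i N) \<notin> I}"
    have "finite T" "u \<in> T" using u contra by (auto simp: T_def in_keys_iff)
    define M where "M = Max ((\<lambda>v. Poly_Mapping.lookup v i) ` T)"
    have "M \<in> (\<lambda>v. Poly_Mapping.lookup v i) ` T"
      unfolding M_def using \<open>finite T\<close> \<open>u \<in> T\<close> by (intro Max_in) auto
    then obtain v where v: "v \<in> T" "Poly_Mapping.lookup v i = M" by auto
    then have "mon (evar i + v) \<notin> I" by (auto simp: T_def add.commute)
    then have "Poly_Mapping.lookup (g * h) (evar i + v) = 0"
      using g(1) monomial_ideal_iff[OF mI] by (metis in_keys_iff)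
    moreover have "Poly_Mapping.lookup g v \<noteq> 0" using v by (simp add: T_def in_keys_iff)
    ultimately obtain j v' where v': "j \<noteq> i" "evar i + v = evar j + v'" "Poly_Mapping.lookup g v' \<noteq> 0"
      using lookup_mult_sum_vars unfolding h_def by blast
    have "Poly_Mapping.lookup (evar i + v) i = Poly_Mapping.lookup (evar j + v') i"
      using v'(2) by simp
    then have "Poly_Mapping.lookup v' i = Suc M"
      using v(2) v'(1) by (simp add: lookup_add lookup_single when_def)
    moreover have "v' \<in> T"
    proof -
      have "mon (v' + Poly_Mapping.single i N) \<notin> I" for N
      proof
        assume "mon (v' + Poly_Mapping.single i N) \<in> I"
        from in_ideal_mon_add[OF I this, of "evar j"]
        have "mon ((evar j + v') + Poly_Mapping.single i N) \<in> I" by (simp add: ac_simps)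
        then have "mon (v + Poly_Mapping.single i (Suc N)) \<in> I"
          unfolding v'(2)[symmetric] by (simp add: ac_simps flip: single_add)
        then show False using v(1) by (auto simp: T_def)
      qed
      then show ?thesis using v'(3) by (simp add: T_def in_keys_iff)
    qed
    then have "Poly_Mapping.lookup v' i \<le> M" unfolding M_def using \<open>finite T\<close> by auto
    ultimately show False by simp
  qed
  with socle_monomial_above[OF I u(2)] show ?thesis by blast
qed

section \<open>Powers of ideals and initial degrees\<close>

lemma is_ideal_ideal_power: "is_ideal (ideal_power I k)"
proof (cases k)
  case 0
  then show ?thesis by (simp add: is_ideal_iff)
next
  case (Suc j)
  then show ?thesis by (simp add: ideal_mult_def is_ideal_span)
qed

lemma ideal_power_SucI: "a \<in> I \<Longrightarrow> b \<in> ideal_power I k \<Longrightarrow> a * b \<in> ideal_power I (Suc k)"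
  by (auto simp: ideal_mult_def intro: ideal_span_base)

lemma power_in_ideal_power: "a \<in> I \<Longrightarrow> a ^ k \<in> ideal_power I k"
  by (induction k) (simp_all add: ideal_power_SucI del: ideal_power.simps(2))

lemma ideal_power_1: "is_ideal I \<Longrightarrow> ideal_power I 1 = I"
proof -
  assume I: "is_ideal I"
  have "{a * b | a b. a \<in> I \<and> b \<in> UNIV} = I"
  proof (intro equalityI subsetI)
    fix x assume "x \<in> {a * b | a b. a \<in> I \<and> b \<in> UNIV}"
    then obtain a b where "x = b * a" "a \<in> I" by (auto simp: mult.commute)
    then show "x \<in> I" using I by (simp add: is_ideal_iff)
  next
    fix x assume "x \<in> I"
    then have "x = x * 1 \<and> x \<in> I \<and> 1 \<in> UNIV" by simp
    then show "x \<in> {a * b | a b. a \<in> I \<and> b \<in> UNIV}" by blast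
  qed
  then show ?thesis by (simp add: ideal_mult_def ideal_gen_eq_self[OF I])
qed

text \<open>The ideal of the polynomials all of whose monomials have degree at least \<open>t\<close>.\<close>

definition order_ge :: "nat \<Rightarrow> ('n::finite, 'a::field) poly_ring set" where
  "order_ge t = {p. \<forall>m\<in>Poly_Mapping.keys p. t \<le> total_degree m}"

lemma order_ge_mult: "p \<in> order_ge s \<Longrightarrow> q \<in> order_ge t \<Longrightarrow> p * q \<in> order_ge (s + t)"
  using keys_mult[of p q] by (fastforce simp: order_ge_def total_degree_add intro: add_mono)

lemma is_ideal_order_ge: "is_ideal (order_ge t :: ('n::finite, 'a::field) poly_ring set)"
  unfolding is_ideal_iff
proof (intro conjI ballI allI)
  show "(0 :: ('n, 'a) poly_ring) \<in> order_ge t" by (simp add: order_ge_def)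
next
  fix x y :: "('n, 'a) poly_ring" assume "x \<in> order_ge t" "y \<in> order_ge t"
  then show "x + y \<in> order_ge t" using keys_add[of x y] by (auto simp: order_ge_def)
next
  fix c x :: "('n, 'a) poly_ring" assume "x \<in> order_ge t"
  moreover have "c \<in> order_ge 0" by (simp add: order_ge_def)
  ultimately show "c * x \<in> order_ge t" using order_ge_mult[of c 0] by simp
qed

lemma ideal_power_subset_order_ge:
  assumes "I \<subseteq> order_ge d"
  shows "ideal_power I k \<subseteq> order_ge (d * k)"
proof (induction k)
  case 0
  show ?case by (auto simp: order_ge_def)
next
  case (Suc k)
  have "{a * b | a b. a \<in> I \<and> b \<in> ideal_power I k} \<subseteq> order_ge (d + d * k)"
    using assms Suc by (auto intro: order_ge_mult)
  then show ?case
    unfolding ideal_power.simps ideal_mult_def mult_Suc_right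
    by (intro ideal_span_minimal is_ideal_order_ge)
qed

lemma initial_degree_generated:
  assumes G: "G \<subseteq> homog d" "I = ideal_gen G" and I: "I \<noteq> {0}"
  shows "initial_degree I = d" "I \<subseteq> order_ge d" "\<exists>g\<in>I \<inter> homog d. g \<noteq> 0"
proof -
  have "G \<subseteq> order_ge d" using G(1) by (auto simp: order_ge_def homog_def)
  then show sub: "I \<subseteq> order_ge d" unfolding G(2) by (intro ideal_span_minimal is_ideal_order_ge)
  show ex: "\<exists>g\<in>I \<inter> homog d. g \<noteq> 0"
  proof (rule ccontr)
    assume "\<not> ?thesis"
    then have "G \<subseteq> {0}" using G ideal_span_base by blast
    then have "I \<subseteq> {0}" unfolding G(2) by (intro ideal_span_minimal) (auto simp: is_ideal_iff)
    then show False using I G(2) ideal_span_zero by blast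
  qed
  show "initial_degree I = d"
    unfolding initial_degree_def
  proof (rule Least_equality)
    show "I \<inter> homog d \<noteq> {0}" using ex by blast
  next
    fix t assume t: "I \<inter> homog t \<noteq> {0}"
    have "0 \<in> I \<inter> homog t" using G(2) ideal_span_zero by (auto simp: zero_in_homog)
    with t obtain p where p: "p \<in> I" "p \<in> homog t" "p \<noteq> 0" by blast
    then obtain m where "m \<in> Poly_Mapping.keys p" by (metis keys_eq_empty equals0I)
    then show "d \<le> t" using p sub by (force simp: homog_def order_ge_def)
  qed
qed

section \<open>The v-number of powers\<close>

lemma colon_associated_degree:
  fixes J :: "('n::finite, 'a::field) poly_ring set"
  assumes J: "is_ideal J" "J \<subseteq> order_ge s" "mon a \<in> J"
    and f: "f \<in> homog t" "colon J f \<in> Ass J"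
  shows "s \<le> t + 1"
proof -
  have prime: "is_prime_ideal (colon J f)" using f(2) by (simp add: Ass_def)
  have "mon a \<in> colon J f" using J(1,3) by (simp add: colon_def is_ideal_iff mult.commute)
  from prime_ideal_contains_var[OF prime this] obtain i where "mon (evar i) * f \<in> J"
    by (auto simp: colon_def)
  moreover have "f \<noteq> 0" using prime J(1) colon_eq_UNIV_iff[OF J(1), of f]
    by (auto simp: is_prime_ideal_def is_ideal_iff)
  then obtain m where m: "m \<in> Poly_Mapping.keys f" by (metis keys_eq_empty equals0I)
  then have "evar i + m \<in> Poly_Mapping.keys (mon (evar i) * f)"
    by (simp add: in_keys_iff lookup_single_mult del: One_nat_def)
  ultimately have "s \<le> total_degree (evar i + m)" using J(2) by (auto simp: order_ge_def)
  also have "\<dots> = t + 1" using m f(1) by (simp add: total_degree_add homog_def)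
  finally show ?thesis .
qed

lemma colon_eq_max_ideal:
  fixes J :: "('n::finite, 'a::field) poly_ring set"
  assumes J: "is_ideal J" and f: "f \<notin> J" "\<And>i. mon (evar i) * f \<in> J"
  shows "colon J f = max_ideal"
proof
  note C = is_ideal_colon[OF J, of f]
  show sub: "max_ideal \<subseteq> colon J f"
    unfolding max_ideal_def using f(2) by (intro ideal_span_minimal C) (auto simp: colon_def)
  show "colon J f \<subseteq> max_ideal"
  proof
    fix p assume p: "p \<in> colon J f"
    define c where "c = Poly_Mapping.lookup p 0"
    have "p - Poly_Mapping.single 0 c \<in> max_ideal"
      by (simp add: in_max_ideal_iff lookup_minus c_def)
    with sub have "p - Poly_Mapping.single 0 c \<in> colon J f" by blast
    from Modules.module.subspace_diff[OF module_mult C p this]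
    have "Poly_Mapping.single 0 c \<in> colon J f" by simp
    then have "Poly_Mapping.single 0 (inverse c) * Poly_Mapping.single 0 c \<in> colon J f"
      using C unfolding is_ideal_iff by blast
    then have "c \<noteq> 0 \<Longrightarrow> 1 \<in> colon J f" by (simp add: mult_single)
    then have "c = 0" using f(1) by (auto simp: colon_def)
    then show "p \<in> max_ideal" by (simp add: c_def in_max_ideal_iff)
  qed
qed

theorem theorem3p6:
  fixes I :: "('n::finite, 'a::field) poly_ring set"
  assumes "is_monomial_ideal I"
    and "I \<noteq> {0}"
    and "I \<noteq> UNIV"
    and "has_linear_powers I"
    and "depth_mod I = 0"
  shows "\<forall>k\<ge>1. int (v_number (ideal_power I k)) = int (initial_degree I) * int k - 1"
proof (intro allI impI)
  fix k :: nat assume k: "1 \<le> k"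
  note I = monomial_ideal_is_ideal[OF assms(1)]
  obtain d where d: "has_linear_resolution d I"
    using assms(4) ideal_power_1[OF I] unfolding has_linear_powers_def by (metis order_refl)
  then obtain G where G: "G \<subseteq> homog d" "I = ideal_gen G"
    by (auto simp: has_linear_resolution_def)
  note init = initial_degree_generated[OF G assms(2)]
  obtain w where w: "mon w \<notin> I" "\<And>i. mon (evar i + w) \<in> I"
    using depth_zero_socle_monomial assms by blast
  have "total_degree w < d"
  proof (rule linear_resolution_socle_degree[OF d _ w(1)])
    show "mon w \<in> homog (total_degree w)" by (simp add: homog_def)
    show "mon (evar i) * mon w \<in> I" for i using w(2)[of i] by (simp add: mon_add del: One_nat_def)
  qed
  \<comment> \<open>Any variable will do.\<close>
  moreover have "d \<le> total_degree (evar undefined + w)"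
    using w(2)[of undefined] init(2) by (fastforce simp: order_ge_def)
  ultimately have deg_w: "d = total_degree w + 1" by (simp add: total_degree_add)
  obtain g where "g \<in> I" "g \<in> homog d" "g \<noteq> 0" using init(3) by blast
  then obtain a where a: "mon a \<in> I" "total_degree a = d"
    using monomial_ideal_iff[OF assms(1)]
    by (metis (mono_tags, lifting) all_not_in_conv homog_def keys_eq_empty mem_Collect_eq)
  define J where "J = ideal_power I k"
  have J: "is_ideal J" "J \<subseteq> order_ge (d * k)" "mon (\<Sum>j<k. a) \<in> J"
    using is_ideal_ideal_power ideal_power_subset_order_ge[OF init(2)] power_in_ideal_power[OF a(1)]
    unfolding J_def mon_power by blast+
  define m where "m = w + (\<Sum>j<k - 1. a)"
  have "total_degree m + 1 = d + d * (k - 1)"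
    by (simp add: m_def total_degree_add total_degree_sum a(2) deg_w)
  also have "\<dots> = d * k" using k by (cases k) auto
  finally have deg_m: "total_degree m + 1 = d * k" .
  have "mon m \<notin> J" using J(2) deg_m by (auto simp: order_ge_def)
  moreover have "mon (evar i) * mon m \<in> J" for i
  proof -
    have "mon (evar i + w) * mon a ^ (k - 1) \<in> ideal_power I (Suc (k - 1))"
      by (intro ideal_power_SucI w(2) power_in_ideal_power a(1))
    then show ?thesis using k
      by (simp add: J_def m_def mon_power mon_add mult.assoc del: ideal_power.simps One_nat_def)
  qed
  ultimately have "colon J (mon m) = max_ideal" by (rule colon_eq_max_ideal[OF J(1)])
  then have "colon J (mon m) \<in> Ass J" using is_prime_max_ideal unfolding Ass_def by force
  moreover have "mon m \<in> homog (d * k - 1)" using deg_m by (auto simp: homog_def)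
  ultimately have "v_number J = d * k - 1"
    unfolding v_number_def using colon_associated_degree[OF J]
    by (intro Least_equality) (auto simp: le_diff_conv)
  moreover have "int (d * k - 1) = int d * int k - 1" using deg_m by (simp flip: of_nat_mult)
  ultimately show "int (v_number (ideal_power I k)) = int (initial_degree I) * int k - 1"
    by (simp add: J_def init(1))
qed

end
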